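(* Let $(\mathcal{E},\mathcal{A})$ and $(\mathcal{F},\mathcal{B})$ be categories with arities and let $F:\mathcal{E}\to\mathcal{F}$ be a functor. Then $F$ respects arities, as a functor $(\mathcal{E},\mathcal{A})\to(\mathcal{F},\mathcal{B})$, if and only if for every object $B$ of $\mathcal{B}$, every object $X$ of $\mathcal{E}$ and every morphism $f:B\to FX$ in $\mathcal{F}$, the factorisation category $\mathrm{Fact}_{\mathcal{A},F}(f)$ is connected.
   Context: All categories are locally small; $\widehat{\mathcal{A}}$ denotes set-valued presheaves on $\mathcal{A}$. A category with arities $(\mathcal{E},\mathcal{A})$ is a category $\mathcal{E}$ with a dense generator $\mathcal{A}$, i.e. a small full subcategory $i_{\mathcal{A}}:\mathcal{A}\hookrightarrow\mathcal{E}$ such that the nerve functor $\nu_{\mathcal{A}}:\mathcal{E}\to\widehat{\mathcal{A}}$, $\nu_{\mathcal{A}}(X)(A)=\mathcal{E}(i_{\mathcal{A}}(A),X)$, is fully faithful. For $X$ in $\mathcal{E}$, $\mathcal{A}/X$ is the full subcategory of $\mathcal{E}/X$ on the arrows $A\to X$ with $A$ in $\mathcal{A}$; the $\mathcal{A}$-cocone over $X$ is the canonical natural transformation from the projection $\mathcal{A}/X\to\mathcal{E}$ to the constant functor at $X$. The functor $F$ respects arities if $\nu_{\mathcal{B}}F$ takes the $\mathcal{A}$-cocones in $\mathcal{E}$ to colimit-cocones in $\widehat{\mathcal{B}}$. For $f:B\to FX$ with $B$ in $\mathcal{B}$ and $X$ in $\mathcal{E}$, the category $\mathrm{Fact}_{\mathcal{A},F}(f)$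 has as objects the triples $(g,A,h)$ with $A$ an object of $\mathcal{A}$, $g:B\to FA$, $h:A\to X$ and $F(h)g=f$; a morphism $(g_1,A_1,h_1)\to(g_2,A_2,h_2)$ is a morphism $k:A_1\to A_2$ in $\mathcal{A}$ with $F(k)g_1=g_2$ and $h_2k=h_1$. Connected means having exactly one connected component (in particular, non-empty). *)

theory Defs
  imports "HOL-Library.FuncSet" "HOL-Library.Equipollence"
begin

text \<open>
  Size is measured by a type \<open>'u\<close> playing the role of the universe: a set is a subset of \<open>'u\<close>.
  A locally small category is one whose hom-sets are subsets of \<open>'u\<close>, its objects being taken
  from an arbitrary, possibly much larger, type; a collection is small if it injects into \<open>'u\<close>.
  Presheaves are valued in \<open>set_cat\<close>, the category of all subsets of \<open>'u\<close>, so that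
  for infinite \<open>'u\<close> it contains a copy of every small set and has small colimits.

  Hom-sets are not required to be disjoint, so composition and the arrow part of a functor carry the
  objects involved as extra arguments.
\<close>

record ('o, 'm) cat =
  Ob :: "'o set"
  Hom :: "'o \<Rightarrow> 'o \<Rightarrow> 'm set"
  Idn :: "'o \<Rightarrow> 'm"
  Cmp :: "'o \<Rightarrow> 'o \<Rightarrow> 'o \<Rightarrow> 'm \<Rightarrow> 'm \<Rightarrow> 'm"
    \<comment> \<open>\<open>Cmp C a b c g f\<close> is the composite of \<open>f : a \<rightarrow> b\<close> followed by \<open>g : b \<rightarrow> c\<close>\<close>

definition is_category :: "('o, 'm) cat \<Rightarrow> bool" where
  "is_category C \<longleftrightarrow>
     (\<forall>a\<in>Ob C. Idn C a \<in> Hom C a a) \<and>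
     (\<forall>a\<in>Ob C. \<forall>b\<in>Ob C. \<forall>c\<in>Ob C. \<forall>f\<in>Hom C a b. \<forall>g\<in>Hom C b c.
        Cmp C a b c g f \<in> Hom C a c) \<and>
     (\<forall>a\<in>Ob C. \<forall>b\<in>Ob C. \<forall>f\<in>Hom C a b.
        Cmp C a a b f (Idn C a) = f \<and> Cmp C a b b (Idn C b) f = f) \<and>
     (\<forall>a\<in>Ob C. \<forall>b\<in>Ob C. \<forall>c\<in>Ob C. \<forall>d\<in>Ob C.
        \<forall>f\<in>Hom C a b. \<forall>g\<in>Hom C b c. \<forall>h\<in>Hom C c d.
        Cmp C a b d (Cmp C b c d h g) f = Cmp C a c d h (Cmp C a b c g f))"

definition op_cat :: "('o, 'm) cat \<Rightarrow> ('o, 'm) cat" where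
  "op_cat C = \<lparr>Ob = Ob C, Hom = (\<lambda>a b. Hom C b a), Idn = Idn C,
               Cmp = (\<lambda>a b c g f. Cmp C c b a f g)\<rparr>"

definition full_subcat :: "('o, 'm) cat \<Rightarrow> 'o set \<Rightarrow> ('o, 'm) cat" where
  "full_subcat C S = C\<lparr>Ob := S\<rparr>"

definition set_cat :: "('u set, 'u \<Rightarrow> 'u) cat" where
  "set_cat = \<lparr>Ob = UNIV, Hom = (\<lambda>S T. S \<rightarrow>\<^sub>E T), Idn = (\<lambda>S. \<lambda>x\<in>S. x),
              Cmp = (\<lambda>S T R g f. compose S g f)\<rparr>"

record ('o, 'm, 'p, 'n) func =
  fobj :: "'o \<Rightarrow> 'p"
  farr :: "'o \<Rightarrow> 'o \<Rightarrow> 'm \<Rightarrow> 'n"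

definition is_functor ::
    "('o, 'm) cat \<Rightarrow> ('p, 'n) cat \<Rightarrow> ('o, 'm, 'p, 'n) func \<Rightarrow> bool" where
  "is_functor C D F \<longleftrightarrow>
     is_category C \<and> is_category D \<and>
     (\<forall>a\<in>Ob C. fobj F a \<in> Ob D) \<and>
     (\<forall>a\<in>Ob C. \<forall>b\<in>Ob C. \<forall>f\<in>Hom C a b. farr F a b f \<in> Hom D (fobj F a) (fobj F b)) \<and>
     (\<forall>a\<in>Ob C. farr F a a (Idn C a) = Idn D (fobj F a)) \<and>
     (\<forall>a\<in>Ob C. \<forall>b\<in>Ob C. \<forall>c\<in>Ob C. \<forall>f\<in>Hom C a b. \<forall>g\<in>Hom C b c.
        farr F a c (Cmp C a b c g f) =
        Cmp D (fobj F a) (fobj F b) (fobj F c) (farr F b c g) (farr F a b f))"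

definition fully_faithful ::
    "('o, 'm) cat \<Rightarrow> ('p, 'n) cat \<Rightarrow> ('o, 'm, 'p, 'n) func \<Rightarrow> bool" where
  "fully_faithful C D F \<longleftrightarrow>
     is_functor C D F \<and>
     (\<forall>a\<in>Ob C. \<forall>b\<in>Ob C. bij_betw (farr F a b) (Hom C a b) (Hom D (fobj F a) (fobj F b)))"

definition comp_func ::
    "('p, 'n, 'q, 'l) func \<Rightarrow> ('o, 'm, 'p, 'n) func \<Rightarrow> ('o, 'm, 'q, 'l) func" where
  "comp_func G F = \<lparr>fobj = (\<lambda>a. fobj G (fobj F a)),
                    farr = (\<lambda>a b f. farr G (fobj F a) (fobj F b) (farr F a b f))\<rparr>"

definition const_func :: "('p, 'n) cat \<Rightarrow> 'p \<Rightarrow> ('o, 'm, 'p, 'n) func" where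
  "const_func D x = \<lparr>fobj = (\<lambda>a. x), farr = (\<lambda>a b f. Idn D x)\<rparr>"

text \<open>
  Families of components are extensional, that is, \<open>undefined\<close> off the objects of the
  source, so that equality of natural transformations is equality of functions.
\<close>

definition nat_trans ::
    "('o, 'm) cat \<Rightarrow> ('p, 'n) cat \<Rightarrow> ('o, 'm, 'p, 'n) func \<Rightarrow> ('o, 'm, 'p, 'n) func
      \<Rightarrow> ('o \<Rightarrow> 'n) \<Rightarrow> bool" where
  "nat_trans C D F G \<eta> \<longleftrightarrow>
     is_functor C D F \<and> is_functor C D G \<and>
     \<eta> \<in> (\<Pi>\<^sub>E a\<in>Ob C. Hom D (fobj F a) (fobj G a)) \<and>
     (\<forall>a\<in>Ob C. \<forall>b\<in>Ob C. \<forall>f\<in>Hom C a b.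
        Cmp D (fobj F a) (fobj F b) (fobj G b) (\<eta> b) (farr F a b f) =
        Cmp D (fobj F a) (fobj G a) (fobj G b) (farr G a b f) (\<eta> a))"

definition functor_cat ::
    "('o, 'm) cat \<Rightarrow> ('p, 'n) cat \<Rightarrow> (('o, 'm, 'p, 'n) func, 'o \<Rightarrow> 'n) cat" where
  "functor_cat C D =
     \<lparr>Ob = {F. is_functor C D F},
      Hom = (\<lambda>F G. {\<eta>. nat_trans C D F G \<eta>}),
      Idn = (\<lambda>F. \<lambda>a\<in>Ob C. Idn D (fobj F a)),
      Cmp = (\<lambda>F G H \<theta> \<eta>. \<lambda>a\<in>Ob C. Cmp D (fobj F a) (fobj G a) (fobj H a) (\<theta> a) (\<eta> a))\<rparr>"

definition presheaf_cat ::
    "('o, 'u) cat \<Rightarrow> (('o, 'u, 'u set, 'u \<Rightarrow> 'u) func, 'o \<Rightarrow> 'u \<Rightarrow> 'u) cat" where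
  "presheaf_cat C = functor_cat (op_cat C) set_cat"

definition is_cocone ::
    "('j, 'k) cat \<Rightarrow> ('o, 'm) cat \<Rightarrow> ('j, 'k, 'o, 'm) func \<Rightarrow> 'o \<Rightarrow> ('j \<Rightarrow> 'm) \<Rightarrow> bool" where
  "is_cocone J C D x \<eta> \<longleftrightarrow> x \<in> Ob C \<and> nat_trans J C D (const_func C x) \<eta>"

definition is_colimit_cocone ::
    "('j, 'k) cat \<Rightarrow> ('o, 'm) cat \<Rightarrow> ('j, 'k, 'o, 'm) func \<Rightarrow> 'o \<Rightarrow> ('j \<Rightarrow> 'm) \<Rightarrow> bool" where
  "is_colimit_cocone J C D x \<eta> \<longleftrightarrow>
     is_cocone J C D x \<eta> \<and>
     (\<forall>y \<theta>. is_cocone J C D y \<theta> \<longrightarrow>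
        (\<exists>!u. u \<in> Hom C x y \<and> (\<forall>j\<in>Ob J. Cmp C (fobj D j) x y u (\<eta> j) = \<theta> j)))"

text \<open>The image under \<open>G\<close> of a cocone \<open>\<eta>\<close> with vertex \<open>x\<close> over \<open>D\<close>, as a cocone over \<open>comp_func G D\<close>.\<close>

definition map_cocone ::
    "('j, 'k) cat \<Rightarrow> ('o, 'm, 'p, 'n) func \<Rightarrow> ('j, 'k, 'o, 'm) func \<Rightarrow> 'o \<Rightarrow> ('j \<Rightarrow> 'm)
      \<Rightarrow> ('j \<Rightarrow> 'n)" where
  "map_cocone J G D x \<eta> = (\<lambda>j\<in>Ob J. farr G (fobj D j) x (\<eta> j))"

definition slice_cat :: "('o, 'm) cat \<Rightarrow> 'o \<Rightarrow> ('o \<times> 'm, 'm) cat" where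
  "slice_cat C x =
     \<lparr>Ob = (SIGMA a : Ob C. Hom C a x),
      Hom = (\<lambda>(a, h) (a', h'). {k \<in> Hom C a a'. Cmp C a a' x h' k = h}),
      Idn = (\<lambda>(a, h). Idn C a),
      Cmp = (\<lambda>(a, h) (a', h') (a'', h''). Cmp C a a' a'')\<rparr>"

definition over_cat :: "('o, 'm) cat \<Rightarrow> 'o set \<Rightarrow> 'o \<Rightarrow> ('o \<times> 'm, 'm) cat" where
  "over_cat C A x = full_subcat (slice_cat C x) {(a, h) \<in> Ob (slice_cat C x). a \<in> A}"

definition slice_proj :: "('o \<times> 'm, 'm, 'o, 'm) func" where
  "slice_proj = \<lparr>fobj = fst, farr = (\<lambda>j j' k. k)\<rparr>"

definition canonical_cocone :: "('o, 'm) cat \<Rightarrow> 'o set \<Rightarrow> 'o \<Rightarrow> ('o \<times> 'm \<Rightarrow> 'm)" where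
  "canonical_cocone C A x = (\<lambda>j\<in>Ob (over_cat C A x). snd j)"

definition nerve ::
    "('o, 'u) cat \<Rightarrow> 'o set
      \<Rightarrow> ('o, 'u, ('o, 'u, 'u set, 'u \<Rightarrow> 'u) func, 'o \<Rightarrow> 'u \<Rightarrow> 'u) func" where
  "nerve C A =
     \<lparr>fobj = (\<lambda>x. \<lparr>fobj = (\<lambda>a. Hom C a x),
                   farr = (\<lambda>a a' k. \<lambda>g\<in>Hom C a x. Cmp C a' a x g k)\<rparr>),
      farr = (\<lambda>x y m. \<lambda>a\<in>A. \<lambda>g\<in>Hom C a x. Cmp C a x y m g)\<rparr>"

definition category_with_arities :: "('o, 'u) cat \<Rightarrow> 'o set \<Rightarrow> bool" where
  "category_with_arities C A \<longleftrightarrow>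
     is_category C \<and> A \<subseteq> Ob C \<and> A \<lesssim> (UNIV :: 'u set) \<and>
     fully_faithful C (presheaf_cat (full_subcat C A)) (nerve C A)"

definition respects_arities ::
    "('e, 'u) cat \<Rightarrow> 'e set \<Rightarrow> ('f, 'u) cat \<Rightarrow> 'f set \<Rightarrow> ('e, 'u, 'f, 'u) func \<Rightarrow> bool" where
  "respects_arities \<E> \<A> \<F> \<B> F \<longleftrightarrow>
     (\<forall>x\<in>Ob \<E>. let G = comp_func (nerve \<F> \<B>) F in
        is_colimit_cocone (over_cat \<E> \<A> x) (presheaf_cat (full_subcat \<F> \<B>))
          (comp_func G slice_proj) (fobj G x)
          (map_cocone (over_cat \<E> \<A> x) G slice_proj x (canonical_cocone \<E> \<A> x)))"

definition fact_cat ::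
    "('e, 'u) cat \<Rightarrow> 'e set \<Rightarrow> ('f, 'u) cat \<Rightarrow> ('e, 'u, 'f, 'u) func
      \<Rightarrow> 'f \<Rightarrow> 'e \<Rightarrow> 'u \<Rightarrow> ('u \<times> 'e \<times> 'u, 'u) cat" where
  "fact_cat \<E> \<A> \<F> F b x f =
     \<lparr>Ob = {(g, a, h). a \<in> \<A> \<and> g \<in> Hom \<F> b (fobj F a) \<and> h \<in> Hom \<E> a x \<and>
                       Cmp \<F> b (fobj F a) (fobj F x) (farr F a x h) g = f},
      Hom = (\<lambda>(g\<^sub>1, a\<^sub>1, h\<^sub>1) (g\<^sub>2, a\<^sub>2, h\<^sub>2).
               {k \<in> Hom \<E> a\<^sub>1 a\<^sub>2.
                  Cmp \<F> b (fobj F a\<^sub>1) (fobj F a\<^sub>2) (farr F a\<^sub>1 a\<^sub>2 k) g\<^sub>1 = g\<^sub>2 \<and>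
                  Cmp \<E> a\<^sub>1 a\<^sub>2 x h\<^sub>2 k = h\<^sub>1}),
      Idn = (\<lambda>(g, a, h). Idn \<E> a),
      Cmp = (\<lambda>(g\<^sub>1, a\<^sub>1, h\<^sub>1) (g\<^sub>2, a\<^sub>2, h\<^sub>2) (g\<^sub>3, a\<^sub>3, h\<^sub>3). Cmp \<E> a\<^sub>1 a\<^sub>2 a\<^sub>3)\<rparr>"

definition arrow_rel :: "('o, 'm) cat \<Rightarrow> 'o rel" where
  "arrow_rel C = {(a, b). a \<in> Ob C \<and> b \<in> Ob C \<and> Hom C a b \<noteq> {}}"

definition connected_components :: "('o, 'm) cat \<Rightarrow> 'o set set" where
  "connected_components C = Ob C // ((arrow_rel C \<union> (arrow_rel C)\<inverse>)\<^sup>* \<inter> Ob C \<times> Ob C)"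

definition connected_cat :: "('o, 'm) cat \<Rightarrow> bool" where
  "connected_cat C \<longleftrightarrow> (\<exists>!K. K \<in> connected_components C)"

end

theory Submission
  imports Defs
begin

text \<open>
  Fix \<open>x\<close> in \<open>\<E>\<close>, and for \<open>b\<close> in \<open>\<B>\<close> consider the triples \<open>(g, a, h)\<close> with \<open>g : b \<rightarrow> F a\<close> and
  \<open>h : a \<rightarrow> x\<close>. They are the elements at \<open>b\<close> of the nerves of the \<open>F a\<close>, indexed by the objects
  \<open>(a, h)\<close> of \<open>\<A>/x\<close>. Since colimits of presheaves are computed pointwise, the colimit of these
  nerves is, at \<open>b\<close>, the set of triples modulo the zigzags generated by the morphisms of \<open>\<A>/x\<close>, and
  the comparison map to the nerve of \<open>F x\<close> sends \<open>(g, a, h)\<close> to \<open>F h \<circ> g\<close>. Zigzags preserve this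
  composite, and those between triples with composite \<open>f\<close> are exactly the zigzags in the
  factorisation category of \<open>f\<close>. Hence the fibre of the comparison map over \<open>f\<close> is the set of
  connected components of that category, and the comparison map is bijective if and only if
  all factorisation categories are connected.

  If they are connected, the universal property of the nerve of \<open>F x\<close> is checked directly
  (\<open>respects_arities_if_connected\<close>): a cocone is constant on connected components
  (\<open>cocone_conn\<close>), so it can be evaluated at any factorisation of \<open>f\<close>. For the converse
  (\<open>connected_if_respects_arities\<close>) the presheaf \<open>components\<close> of triples modulo zigzags is
  constructed, and the universal property of the nerve of \<open>F x\<close> provides an inverse to the comparison
  map \<open>components_to_nerve\<close>. This is where \<open>'u\<close> has to be infinite: as \<open>\<A>\<close> is small, the
  components can then be encoded as elements of \<open>'u\<close> (\<open>inj_on_encode\<close>).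
\<close>

section \<open>Categories, functors and cocones\<close>

lemma cat_idn: "is_category C \<Longrightarrow> a \<in> Ob C \<Longrightarrow> Idn C a \<in> Hom C a a"
  by (simp add: is_category_def)

lemma cat_cmp:
  "is_category C \<Longrightarrow> a \<in> Ob C \<Longrightarrow> b \<in> Ob C \<Longrightarrow> c \<in> Ob C \<Longrightarrow> f \<in> Hom C a b \<Longrightarrow> g \<in> Hom C b c
    \<Longrightarrow> Cmp C a b c g f \<in> Hom C a c"
  by (simp add: is_category_def)

lemma cat_idn_right:
  "is_category C \<Longrightarrow> a \<in> Ob C \<Longrightarrow> b \<in> Ob C \<Longrightarrow> f \<in> Hom C a b \<Longrightarrow> Cmp C a a b f (Idn C a) = f"
  by (simp add: is_category_def)

lemma cat_idn_left:
  "is_category C \<Longrightarrow> a \<in> Ob C \<Longrightarrow> b \<in> Ob C \<Longrightarrow> f \<in> Hom C a b \<Longrightarrow> Cmp C a b b (Idn C b) f = f"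
  by (simp add: is_category_def)

lemma cat_assoc:
  "is_category C \<Longrightarrow> a \<in> Ob C \<Longrightarrow> b \<in> Ob C \<Longrightarrow> c \<in> Ob C \<Longrightarrow> d \<in> Ob C
    \<Longrightarrow> f \<in> Hom C a b \<Longrightarrow> g \<in> Hom C b c \<Longrightarrow> h \<in> Hom C c d
    \<Longrightarrow> Cmp C a b d (Cmp C b c d h g) f = Cmp C a c d h (Cmp C a b c g f)"
  unfolding is_category_def by blast

lemma fun_source: "is_functor C D F \<Longrightarrow> is_category C"
  and fun_target: "is_functor C D F \<Longrightarrow> is_category D"
  and fun_obj: "is_functor C D F \<Longrightarrow> a \<in> Ob C \<Longrightarrow> fobj F a \<in> Ob D"
  and fun_arr: "is_functor C D F \<Longrightarrow> a \<in> Ob C \<Longrightarrow> b \<in> Ob C \<Longrightarrow> f \<in> Hom C a b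
    \<Longrightarrow> farr F a b f \<in> Hom D (fobj F a) (fobj F b)"
  and fun_idn: "is_functor C D F \<Longrightarrow> a \<in> Ob C \<Longrightarrow> farr F a a (Idn C a) = Idn D (fobj F a)"
  and fun_cmp: "is_functor C D F \<Longrightarrow> a \<in> Ob C \<Longrightarrow> b \<in> Ob C \<Longrightarrow> c \<in> Ob C
    \<Longrightarrow> f \<in> Hom C a b \<Longrightarrow> g \<in> Hom C b c
    \<Longrightarrow> farr F a c (Cmp C a b c g f) =
        Cmp D (fobj F a) (fobj F b) (fobj F c) (farr F b c g) (farr F a b f)"
  by (simp_all add: is_functor_def)

lemma is_functor_comp:
  assumes "is_functor C D F" and "is_functor D D' G"
  shows "is_functor C D' (comp_func G F)"
  using assms by (simp add: is_functor_def comp_func_def)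

lemma is_functor_const:
  assumes "is_category J" and "is_category C" and "x \<in> Ob C"
  shows "is_functor J C (const_func C x)"
  using assms by (simp add: is_functor_def const_func_def cat_idn cat_idn_left)

lemma is_category_full_subcat:
  assumes "is_category C" and "S \<subseteq> Ob C"
  shows "is_category (full_subcat C S)"
proof -
  have [simp]: "Ob (full_subcat C S) = S" "Hom (full_subcat C S) = Hom C"
    "Idn (full_subcat C S) = Idn C" "Cmp (full_subcat C S) = Cmp C"
    by (simp_all add: full_subcat_def)
  have S: "a \<in> Ob C" if "a \<in> S" for a
    using assms(2) that by blast
  show ?thesis
    unfolding is_category_def[of "full_subcat C S"]
    by (simp add: S cat_idn[OF assms(1)] cat_cmp[OF assms(1)] cat_idn_left[OF assms(1)]
        cat_idn_right[OF assms(1)] cat_assoc[OF assms(1)])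
qed

lemma is_category_op_cat:
  assumes "is_category C"
  shows "is_category (op_cat C)"
  unfolding is_category_def op_cat_def
  using cat_idn[OF assms] cat_cmp[OF assms] cat_idn_left[OF assms] cat_idn_right[OF assms]
    cat_assoc[OF assms] by simp

lemma is_category_set_cat: "is_category set_cat"
  unfolding is_category_def set_cat_def
  by (auto simp: compose_def fun_eq_iff PiE_iff extensional_def)

lemma connected_cat_iff:
  "connected_cat C \<longleftrightarrow>
    Ob C \<noteq> {} \<and> (\<forall>s\<in>Ob C. \<forall>t\<in>Ob C. (s, t) \<in> (arrow_rel C \<union> (arrow_rel C)\<inverse>)\<^sup>*)"
proof -
  define R where "R = (arrow_rel C \<union> (arrow_rel C)\<inverse>)\<^sup>*"
  have s: "sym R"
    unfolding R_def by (intro sym_rtrancl sym_Un_converse)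
  have r: "refl R" and t: "trans R"
    unfolding R_def by (simp_all add: refl_rtrancl trans_rtrancl)
  have eq: "equiv (Ob C) (R \<inter> Ob C \<times> Ob C)"
  proof (rule equivI)
    show "refl_on (Ob C) (R \<inter> Ob C \<times> Ob C)"
      using r by (auto simp: refl_on_def)
    show "sym (R \<inter> Ob C \<times> Ob C)"
      using symD[OF s] by (intro symI) blast
    show "trans (R \<inter> Ob C \<times> Ob C)"
      using transD[OF t] by (intro transI) blast
  qed auto
  have 1: "(R \<inter> Ob C \<times> Ob C) `` {a} = (R \<inter> Ob C \<times> Ob C) `` {b} \<longleftrightarrow> (a, b) \<in> R"
    if "a \<in> Ob C" "b \<in> Ob C" for a b
    using eq_equiv_class_iff[OF eq that] that by simp
  have "connected_cat C \<longleftrightarrow> Ob C \<noteq> {} \<and> (\<forall>a\<in>Ob C. \<forall>b\<in>Ob C.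
      (R \<inter> Ob C \<times> Ob C) `` {a} = (R \<inter> Ob C \<times> Ob C) `` {b})"
    unfolding connected_cat_def connected_components_def R_def[symmetric] quotient_def by blast
  then show ?thesis
    using 1 unfolding R_def by blast
qed

section \<open>Presheaves\<close>

lemma Hom_presheaf_cat:
  "\<eta> \<in> Hom (presheaf_cat C) P Q \<longleftrightarrow>
     P \<in> Ob (presheaf_cat C) \<and> Q \<in> Ob (presheaf_cat C) \<and>
     \<eta> \<in> (\<Pi>\<^sub>E b\<in>Ob C. fobj P b \<rightarrow>\<^sub>E fobj Q b) \<and>
     (\<forall>b\<in>Ob C. \<forall>b'\<in>Ob C. \<forall>k\<in>Hom C b b'. \<forall>s\<in>fobj P b'.
        \<eta> b (farr P b' b k s) = farr Q b' b k (\<eta> b' s))"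
proof -
  have "compose (fobj P b') (\<eta> b) (farr P b' b k) = compose (fobj P b') (farr Q b' b k) (\<eta> b') \<longleftrightarrow>
      (\<forall>s\<in>fobj P b'. \<eta> b (farr P b' b k s) = farr Q b' b k (\<eta> b' s))" for b b' k
    by (auto simp: compose_def fun_eq_iff)
  then show ?thesis
    unfolding presheaf_cat_def functor_cat_def nat_trans_def
    by (auto simp: op_cat_def set_cat_def)
qed

lemma over_cat_simps:
  "Ob (over_cat C S x) = {(a, h). a \<in> S \<and> a \<in> Ob C \<and> h \<in> Hom C a x}"
  "Hom (over_cat C S x) (a, h) (a', h') = {k \<in> Hom C a a'. Cmp C a a' x h' k = h}"
  "Idn (over_cat C S x) (a, h) = Idn C a"
  "Cmp (over_cat C S x) (a, h) (a', h') (a'', h'') = Cmp C a a' a''"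
  by (auto simp: over_cat_def slice_cat_def full_subcat_def)

lemma is_category_over_cat:
  assumes C: "is_category C" and x: "x \<in> Ob C"
  shows "is_category (over_cat C S x)"
  unfolding is_category_def
proof (intro conjI ballI, goal_cases)
  case (1 j)
  then show ?case
    using x by (auto simp: over_cat_simps cat_idn[OF C] cat_idn_right[OF C])
next
  case (2 j1 j2 j3 k l)
  obtain a h where j1: "j1 = (a, h)" by fastforce
  obtain a' h' where j2: "j2 = (a', h')" by fastforce
  obtain a'' h'' where j3: "j3 = (a'', h'')" by fastforce
  from 2 show ?case
    unfolding j1 j2 j3 using cat_assoc[OF C, of a a' a'' x k l h''] x
    by (auto simp: over_cat_simps intro: cat_cmp[OF C])
next
  case (3 j1 j2 k)
  then show ?case
    by (auto simp: over_cat_simps cat_idn_right[OF C])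
next
  case (4 j1 j2 k)
  then show ?case
    by (auto simp: over_cat_simps cat_idn_left[OF C])
next
  case (5 j1 j2 j3 j4 k l m)
  then show ?case
    by (cases j1, cases j2, cases j3, cases j4) (auto simp: over_cat_simps intro: cat_assoc[OF C])
qed

lemma is_functor_slice_proj:
  assumes "is_category C" and "x \<in> Ob C"
  shows "is_functor (over_cat C S x) C slice_proj"
  unfolding is_functor_def
  using is_category_over_cat[OF assms] assms(1)
  by (auto simp: slice_proj_def over_cat_simps)

section \<open>Factorisations and cocones of presheaves\<close>

text \<open>A functor \<open>F\<close> between categories with arities \<open>(E, A)\<close> and \<open>(D, B)\<close>. Below, \<open>PB\<close> is the category
  of presheaves on \<open>B\<close>, \<open>G\<close> the functor \<open>F\<close> followed by the nerve, and \<open>J x\<close> the index category of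
  the canonical cocone over \<open>x\<close>.\<close>

locale arity_functor =
  fixes E :: "('e, 'u) cat" and A :: "'e set"
    and D :: "('f, 'u) cat" and B :: "'f set"
    and F :: "('e, 'u, 'f, 'u) func"
  assumes EA: "category_with_arities E A"
    and DB: "category_with_arities D B"
    and F: "is_functor E D F"
begin

abbreviation "PB \<equiv> presheaf_cat (full_subcat D B)"
abbreviation "G \<equiv> comp_func (nerve D B) F"
abbreviation "J x \<equiv> over_cat E A x"
abbreviation "Fact b x f \<equiv> fact_cat E A D F b x f"

text \<open>Connectedness by a zigzag in the factorisation category of \<open>f\<close>. Every triple is
  related to itself, also when it does not factorise \<open>f\<close>.\<close>

definition conn :: "'f \<Rightarrow> 'e \<Rightarrow> 'u \<Rightarrow> ('u \<times> 'e \<times> 'u) rel" where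
  "conn b x f = (arrow_rel (Fact b x f) \<union> (arrow_rel (Fact b x f))\<inverse>)\<^sup>*"

text \<open>The triples \<open>(g, a, h)\<close> with \<open>g : b \<rightarrow> F a\<close> and \<open>h : a \<rightarrow> x\<close>: the disjoint union, over
  all \<open>f : b \<rightarrow> F x\<close>, of the objects of the factorisation categories of \<open>f\<close>.\<close>

definition triples :: "'f \<Rightarrow> 'e \<Rightarrow> ('u \<times> 'e \<times> 'u) set" where
  "triples b x = {(g, a, h). a \<in> A \<and> g \<in> Hom D b (fobj F a) \<and> h \<in> Hom E a x}"

text \<open>The morphism \<open>F h \<circ> g\<close> that \<open>(g, a, h)\<close> factorises.\<close>

definition composite :: "'f \<Rightarrow> 'e \<Rightarrow> 'u \<times> 'e \<times> 'u \<Rightarrow> 'u" where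
  "composite b x = (\<lambda>(g, a, h). Cmp D b (fobj F a) (fobj F x) (farr F a x h) g)"

text \<open>Precomposition of the first entry with \<open>k : b \<rightarrow> b'\<close>.\<close>

definition restr :: "'f \<Rightarrow> 'f \<Rightarrow> 'u \<Rightarrow> 'u \<times> 'e \<times> 'u \<Rightarrow> 'u \<times> 'e \<times> 'u" where
  "restr b' b k = (\<lambda>(g, a, h). (Cmp D b b' (fobj F a) g k, a, h))"

lemma E: "is_category E" and D: "is_category D"
  using EA DB by (simp_all add: category_with_arities_def)

lemma A_Ob: "a \<in> A \<Longrightarrow> a \<in> Ob E" and B_Ob: "b \<in> B \<Longrightarrow> b \<in> Ob D"
  using EA DB by (auto simp: category_with_arities_def)

lemma F_Ob: "a \<in> Ob E \<Longrightarrow> fobj F a \<in> Ob D"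
  by (rule fun_obj[OF F])

lemma G_functor: "is_functor E PB G"
proof (rule is_functor_comp[OF F])
  show "is_functor D PB (nerve D B)"
    using DB by (simp add: category_with_arities_def fully_faithful_def)
qed

lemma PB: "is_category PB"
  by (rule fun_target[OF G_functor])

lemma Ob_J: "Ob (J x) = {(a, h). a \<in> A \<and> h \<in> Hom E a x}"
  using A_Ob by (auto simp: over_cat_simps)

lemma G_proj: "fobj (comp_func G slice_proj) (a, h) = fobj G a"
    "farr (comp_func G slice_proj) (a, h) (a', h') k = farr G a a' k"
  by (simp_all add: comp_func_def slice_proj_def)

lemma fobj_G: "fobj (fobj G a) b = Hom D b (fobj F a)"
  and farr_fobj_G: "g \<in> Hom D b' (fobj F a) \<Longrightarrow>
    farr (fobj G a) b' b k g = Cmp D b b' (fobj F a) g k"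
  and farr_G: "b \<in> B \<Longrightarrow> g \<in> Hom D b (fobj F a) \<Longrightarrow>
    farr G a a' m b g = Cmp D b (fobj F a) (fobj F a') (farr F a a' m) g"
  by (simp_all add: comp_func_def nerve_def)

lemma Hom_PB:
  "\<eta> \<in> Hom PB P Q \<longleftrightarrow>
     P \<in> Ob PB \<and> Q \<in> Ob PB \<and> \<eta> \<in> (\<Pi>\<^sub>E b\<in>B. fobj P b \<rightarrow>\<^sub>E fobj Q b) \<and>
     (\<forall>b\<in>B. \<forall>b'\<in>B. \<forall>k\<in>Hom D b b'. \<forall>s\<in>fobj P b'.
        \<eta> b (farr P b' b k s) = farr Q b' b k (\<eta> b' s))"
  by (simp add: Hom_presheaf_cat full_subcat_def)

lemma Hom_PB_mem: "\<eta> \<in> Hom PB P Q \<Longrightarrow> b \<in> B \<Longrightarrow> s \<in> fobj P b \<Longrightarrow> \<eta> b s \<in> fobj Q b"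
  unfolding Hom_PB by (blast dest: PiE_mem)

lemma Cmp_PB: "b \<in> B \<Longrightarrow> s \<in> fobj P b \<Longrightarrow> Cmp PB P Q R \<theta> \<eta> b s = \<theta> b (\<eta> b s)"
  and Idn_PB: "b \<in> B \<Longrightarrow> s \<in> fobj P b \<Longrightarrow> Idn PB P b s = s"
  by (simp_all add: presheaf_cat_def functor_cat_def op_cat_def full_subcat_def set_cat_def
      compose_def)

lemma Hom_PB_eqI:
  assumes "\<eta> \<in> Hom PB P Q" and "\<theta> \<in> Hom PB P Q"
    and "\<And>b s. b \<in> B \<Longrightarrow> s \<in> fobj P b \<Longrightarrow> \<eta> b s = \<theta> b s"
  shows "\<eta> = \<theta>"
proof (rule PiE_ext)
  show 1: "\<eta> \<in> (\<Pi>\<^sub>E b\<in>B. fobj P b \<rightarrow>\<^sub>E fobj Q b)" and 2: "\<theta> \<in> (\<Pi>\<^sub>E b\<in>B. fobj P b \<rightarrow>\<^sub>E fobj Q b)"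
    using assms(1,2) by (simp_all add: Hom_PB)
  show "\<eta> b = \<theta> b" if "b \<in> B" for b
    by (rule PiE_ext[OF PiE_mem[OF 1 that] PiE_mem[OF 2 that]]) (rule assms(3)[OF that])
qed

text \<open>An equality of transformations out of the nerve of \<open>F a\<close>, tested on elements.\<close>

lemma precomp_G_iff:
  assumes "a \<in> Ob E" "a' \<in> Ob E" "k \<in> Hom E a a'"
    and u: "u \<in> Hom PB (fobj G a') P" and w: "w \<in> Hom PB (fobj G a) P"
  shows "Cmp PB (fobj G a) (fobj G a') P u (farr G a a' k) = w \<longleftrightarrow>
    (\<forall>b\<in>B. \<forall>g\<in>Hom D b (fobj F a).
       u b (Cmp D b (fobj F a) (fobj F a') (farr F a a' k) g) = w b g)" (is "?c = w \<longleftrightarrow> ?R")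
proof -
  have "P \<in> Ob PB"
    using u by (simp add: Hom_PB)
  then have c: "?c \<in> Hom PB (fobj G a) P"
    by (intro cat_cmp[OF PB] fun_arr[OF G_functor] fun_obj[OF G_functor] assms)
  have "?c = w \<longleftrightarrow> (\<forall>b\<in>B. \<forall>g\<in>Hom D b (fobj F a). ?c b g = w b g)"
    using Hom_PB_eqI[OF c w] unfolding fobj_G by blast
  also have "\<dots> \<longleftrightarrow> ?R"
    by (intro ball_cong refl) (simp add: Cmp_PB fobj_G farr_G)
  finally show ?thesis .
qed

text \<open>A cocone \<open>\<theta>\<close> with vertex \<open>P\<close> assigns to each triple \<open>(g, a, h)\<close> an element \<open>\<theta> (a, h) b g\<close> of
  \<open>P b\<close>, naturally in \<open>b\<close>; the cocone condition says that this element depends only on the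
  connected component of the triple.\<close>

lemma cocone_iff:
  assumes x: "x \<in> Ob E"
  shows "is_cocone (J x) PB (comp_func G slice_proj) P \<theta> \<longleftrightarrow>
    P \<in> Ob PB \<and> \<theta> \<in> extensional (Ob (J x)) \<and>
    (\<forall>a\<in>A. \<forall>h\<in>Hom E a x. \<theta> (a, h) \<in> Hom PB (fobj G a) P) \<and>
    (\<forall>a\<in>A. \<forall>a'\<in>A. \<forall>h'\<in>Hom E a' x. \<forall>k\<in>Hom E a a'. \<forall>b\<in>B. \<forall>g\<in>Hom D b (fobj F a).
       \<theta> (a', h') b (Cmp D b (fobj F a) (fobj F a') (farr F a a' k) g) =
       \<theta> (a, Cmp E a a' x h' k) b g)" (is "?L \<longleftrightarrow> P \<in> Ob PB \<and> ?ext \<and> ?hom \<and> ?nat")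
proof (cases "P \<in> Ob PB \<and> ?ext \<and> ?hom")
  case True
  then have P: "P \<in> Ob PB"
    and hom: "a \<in> A \<Longrightarrow> h \<in> Hom E a x \<Longrightarrow> \<theta> (a, h) \<in> Hom PB (fobj G a) P" for a h
    by simp_all
  have 1: "is_functor (J x) PB (comp_func G slice_proj)"
    by (rule is_functor_comp[OF is_functor_slice_proj[OF E x] G_functor])
  have 2: "is_functor (J x) PB (const_func PB P)"
    by (rule is_functor_const[OF is_category_over_cat[OF E x] PB P])
  have 3: "\<theta> \<in> (\<Pi>\<^sub>E j\<in>Ob (J x). Hom PB (fobj (comp_func G slice_proj) j) P)"
    using True by (auto simp: PiE_iff Ob_J G_proj)
  have "?L \<longleftrightarrow> (\<forall>j\<in>Ob (J x). \<forall>j'\<in>Ob (J x). \<forall>k\<in>Hom (J x) j j'.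
      Cmp PB (fobj (comp_func G slice_proj) j) (fobj (comp_func G slice_proj) j') P
        (\<theta> j') (farr (comp_func G slice_proj) j j' k) =
      Cmp PB (fobj (comp_func G slice_proj) j) P P (Idn PB P) (\<theta> j))"
    using P 1 2 3 by (simp add: is_cocone_def nat_trans_def const_func_def)
  also have "\<dots> \<longleftrightarrow> (\<forall>j\<in>Ob (J x). \<forall>j'\<in>Ob (J x). \<forall>k\<in>Hom (J x) j j'.
      Cmp PB (fobj (comp_func G slice_proj) j) (fobj (comp_func G slice_proj) j') P
        (\<theta> j') (farr (comp_func G slice_proj) j j' k) = \<theta> j)"
    using cat_idn_left[OF PB fun_obj[OF 1] P PiE_mem[OF 3]] by simp
  also have "\<dots> \<longleftrightarrow> (\<forall>a\<in>A. \<forall>a'\<in>A. \<forall>h'\<in>Hom E a' x. \<forall>k\<in>Hom E a a'.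
      Cmp PB (fobj G a) (fobj G a') P (\<theta> (a', h')) (farr G a a' k) = \<theta> (a, Cmp E a a' x h' k))"
    using cat_cmp[OF E A_Ob A_Ob x] by (auto simp: Ob_J G_proj over_cat_simps(2))
  also have "\<dots> \<longleftrightarrow> ?nat"
    by (intro ball_cong refl precomp_G_iff A_Ob hom cat_cmp[OF E A_Ob A_Ob x])
  finally show ?thesis using True by blast
next
  case False
  have "P \<in> Ob PB \<and> ?ext \<and> ?hom" if ?L
  proof -
    have P: "P \<in> Ob PB" and
      \<theta>: "\<theta> \<in> (\<Pi>\<^sub>E j\<in>Ob (J x). Hom PB (fobj (comp_func G slice_proj) j) P)"
      using that by (simp_all add: is_cocone_def nat_trans_def const_func_def)
    have "\<theta> (a, h) \<in> Hom PB (fobj G a) P" if "a \<in> A" "h \<in> Hom E a x" for a h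
      using PiE_mem[OF \<theta>, of "(a, h)"] that by (simp add: Ob_J G_proj)
    with P \<theta> show ?thesis by (simp add: PiE_iff)
  qed
  with False show ?thesis by blast
qed

lemma canonical_cocone_apply:
  assumes "a \<in> A" "h \<in> Hom E a x"
  shows "map_cocone (J x) G slice_proj x (canonical_cocone E A x) (a, h) = farr G a x h"
  using assms by (simp add: map_cocone_def canonical_cocone_def Ob_J slice_proj_def)

lemma farr_G_composite:
  "b \<in> B \<Longrightarrow> g \<in> Hom D b (fobj F a) \<Longrightarrow> farr G a x h b g = composite b x (g, a, h)"
  by (simp add: farr_G composite_def)

lemma composite_in_Hom:
  "b \<in> B \<Longrightarrow> x \<in> Ob E \<Longrightarrow> t \<in> triples b x \<Longrightarrow> composite b x t \<in> Hom D b (fobj F x)"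
  by (auto simp: triples_def composite_def cat_cmp[OF D] fun_arr[OF F] F_Ob A_Ob B_Ob)

lemma restr_in_triples:
  "b \<in> B \<Longrightarrow> b' \<in> B \<Longrightarrow> k \<in> Hom D b b' \<Longrightarrow> t \<in> triples b' x \<Longrightarrow> restr b' b k t \<in> triples b x"
  by (auto simp: triples_def restr_def cat_cmp[OF D] F_Ob A_Ob B_Ob)

lemma composite_restr:
  "b \<in> B \<Longrightarrow> b' \<in> B \<Longrightarrow> x \<in> Ob E \<Longrightarrow> k \<in> Hom D b b' \<Longrightarrow> t \<in> triples b' x \<Longrightarrow>
    composite b x (restr b' b k t) = Cmp D b b' (fobj F x) (composite b' x t) k"
  by (auto simp: triples_def composite_def restr_def
      cat_assoc[OF D] fun_arr[OF F] F_Ob A_Ob B_Ob)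

text \<open>A morphism \<open>k : a \<rightarrow> a'\<close> relates \<open>(g, a, h' \<circ> k)\<close> and \<open>(F k \<circ> g, a', h')\<close>, which factorise the
  same morphism.\<close>

lemma composite_transport:
  assumes "b \<in> B" "x \<in> Ob E" "a \<in> A" "a' \<in> A" "k \<in> Hom E a a'" "h' \<in> Hom E a' x"
    and "g \<in> Hom D b (fobj F a)"
  shows "composite b x (Cmp D b (fobj F a) (fobj F a') (farr F a a' k) g, a', h') =
    composite b x (g, a, Cmp E a a' x h' k)"
  using assms cat_assoc[OF D, of b "fobj F a" "fobj F a'" "fobj F x" g]
  by (simp add: composite_def fun_cmp[OF F A_Ob A_Ob] fun_arr[OF F] F_Ob A_Ob B_Ob)

lemma canonical_is_cocone:
  assumes x: "x \<in> Ob E"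
  shows "is_cocone (J x) PB (comp_func G slice_proj) (fobj G x)
    (map_cocone (J x) G slice_proj x (canonical_cocone E A x))"
  unfolding cocone_iff[OF x]
proof (intro conjI ballI)
  show "map_cocone (J x) G slice_proj x (canonical_cocone E A x) \<in> extensional (Ob (J x))"
    by (simp add: map_cocone_def)
qed (auto simp: canonical_cocone_apply farr_G_composite composite_transport x
    fun_obj[OF G_functor] fun_arr[OF G_functor] A_Ob B_Ob F_Ob cat_cmp[OF E]
    cat_cmp[OF D] fun_arr[OF F])

text \<open>The universal property in terms of elements: \<open>u\<close> factors \<open>\<theta>\<close> through the canonical cocone
  precisely when it sends the morphism factorised by \<open>(g, a, h)\<close> to \<open>\<theta> (a, h) b g\<close>.\<close>

lemma respects_arities_iff:
  "respects_arities E A D B F \<longleftrightarrow>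
    (\<forall>x\<in>Ob E. \<forall>P \<theta>. is_cocone (J x) PB (comp_func G slice_proj) P \<theta> \<longrightarrow>
      (\<exists>!u. u \<in> Hom PB (fobj G x) P \<and>
        (\<forall>b\<in>B. \<forall>(g, a, h)\<in>triples b x. u b (composite b x (g, a, h)) = \<theta> (a, h) b g)))"
proof -
  have eq: "(\<forall>j\<in>Ob (J x). Cmp PB (fobj (comp_func G slice_proj) j) (fobj G x) P u
        (map_cocone (J x) G slice_proj x (canonical_cocone E A x) j) = \<theta> j) \<longleftrightarrow>
      (\<forall>b\<in>B. \<forall>(g, a, h)\<in>triples b x. u b (composite b x (g, a, h)) = \<theta> (a, h) b g)"
    (is "?L \<longleftrightarrow> ?R")
    if x: "x \<in> Ob E" and c: "is_cocone (J x) PB (comp_func G slice_proj) P \<theta>"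
      and u: "u \<in> Hom PB (fobj G x) P" for x P \<theta> u
  proof -
    have hom: "a \<in> A \<Longrightarrow> h \<in> Hom E a x \<Longrightarrow> \<theta> (a, h) \<in> Hom PB (fobj G a) P" for a h
      using c by (simp add: cocone_iff[OF x])
    have "?L \<longleftrightarrow> (\<forall>a\<in>A. \<forall>h\<in>Hom E a x.
        Cmp PB (fobj G a) (fobj G x) P u (farr G a x h) = \<theta> (a, h))"
      by (auto simp: Ob_J canonical_cocone_apply G_proj)
    also have "\<dots> \<longleftrightarrow> (\<forall>a\<in>A. \<forall>h\<in>Hom E a x. \<forall>b\<in>B. \<forall>g\<in>Hom D b (fobj F a).
        u b (Cmp D b (fobj F a) (fobj F x) (farr F a x h) g) = \<theta> (a, h) b g)"
      by (intro ball_cong refl precomp_G_iff A_Ob x u hom)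
    also have "\<dots> \<longleftrightarrow> ?R"
      by (auto simp: triples_def composite_def)
    finally show ?thesis .
  qed
  show ?thesis
    unfolding respects_arities_def is_colimit_cocone_def Let_def
    using canonical_is_cocone eq by (simp cong: conj_cong)
qed

lemma Ob_fact: "Ob (Fact b x f) = {t \<in> triples b x. composite b x t = f}"
  by (auto simp: fact_cat_def triples_def composite_def)

lemma arrow_rel_factD:
  assumes "((g, a, h), (g', a', h')) \<in> arrow_rel (Fact b x f)"
  obtains k where "k \<in> Hom E a a'" "Cmp D b (fobj F a) (fobj F a') (farr F a a' k) g = g'"
    "Cmp E a a' x h' k = h"
  using assms by (auto simp: arrow_rel_def fact_cat_def)

lemma conn_refl: "(t, t) \<in> conn b x f"
  by (simp add: conn_def)

lemma conn_sym: "(s, t) \<in> conn b x f \<Longrightarrow> (t, s) \<in> conn b x f"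
  unfolding conn_def by (rule symD[OF sym_rtrancl[OF sym_Un_converse]])

lemma conn_trans: "(r, s) \<in> conn b x f \<Longrightarrow> (s, t) \<in> conn b x f \<Longrightarrow> (r, t) \<in> conn b x f"
  unfolding conn_def by (rule rtrancl_trans)

lemma connected_Fact_iff:
  "connected_cat (Fact b x f) \<longleftrightarrow>
    (\<exists>t\<in>triples b x. composite b x t = f) \<and>
    (\<forall>s\<in>triples b x. \<forall>t\<in>triples b x.
      composite b x s = f \<longrightarrow> composite b x t = f \<longrightarrow> (s, t) \<in> conn b x f)"
  unfolding connected_cat_iff conn_def by (auto simp: Ob_fact)

lemma conn_Ob:
  assumes "(s, t) \<in> conn b x f" and "s \<in> Ob (Fact b x f)"
  shows "t \<in> Ob (Fact b x f)"
  using assms unfolding conn_def by (induction rule: rtrancl_induct) (auto simp: arrow_rel_def)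

section \<open>Connected factorisation categories give colimits\<close>

text \<open>A cocone is constant on connected components of factorisation categories.\<close>

lemma cocone_conn:
  assumes x: "x \<in> Ob E" and c: "is_cocone (J x) PB (comp_func G slice_proj) P \<theta>" and b: "b \<in> B"
    and conn: "((g, a, h), (g', a', h')) \<in> conn b x f"
  shows "\<theta> (a, h) b g = \<theta> (a', h') b g'"
proof -
  define val where "val = (\<lambda>(g, a, h). \<theta> (a, h) b g)"
  have step: "val s = val t" if st: "(s, t) \<in> arrow_rel (Fact b x f)" for s t
  proof -
    obtain g a h g' a' h' where s: "s = (g, a, h)" and t: "t = (g', a', h')"
      by (metis prod_cases3)
    obtain k where k: "k \<in> Hom E a a'" "Cmp D b (fobj F a) (fobj F a') (farr F a a' k) g = g'"
      "Cmp E a a' x h' k = h"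
      using st unfolding s t by (rule arrow_rel_factD)
    have "(g, a, h) \<in> triples b x" "(g', a', h') \<in> triples b x"
      using that by (auto simp: s t arrow_rel_def Ob_fact)
    then have "a \<in> A" "a' \<in> A" "h' \<in> Hom E a' x" "g \<in> Hom D b (fobj F a)"
      by (auto simp: triples_def)
    then have "\<theta> (a', h') b (Cmp D b (fobj F a) (fobj F a') (farr F a a' k) g) =
        \<theta> (a, Cmp E a a' x h' k) b g"
      using c k(1) b unfolding cocone_iff[OF x] by blast
    then show ?thesis
      by (simp add: val_def s t k)
  qed
  have "val s = val t" if "(s, t) \<in> conn b x f" for s t
    using that unfolding conn_def by (induction rule: rtrancl_induct) (auto dest: step)
  from this[OF conn] show ?thesis
    by (simp add: val_def)
qed

text \<open>Compatibility with the canonical cocone forces \<open>u b (F h \<circ> g) = \<theta> (a, h) b g\<close>. Non-emptiness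
  of the factorisation categories makes this determine \<open>u\<close>, and their connectedness makes it
  well-defined.\<close>

lemma respects_arities_if_connected:
  assumes conn: "\<And>b x f. b \<in> B \<Longrightarrow> x \<in> Ob E \<Longrightarrow> f \<in> Hom D b (fobj F x) \<Longrightarrow>
    connected_cat (Fact b x f)"
  shows "respects_arities E A D B F"
  unfolding respects_arities_iff
proof (intro ballI allI impI)
  fix x P \<theta>
  assume x: "x \<in> Ob E" and c: "is_cocone (J x) PB (comp_func G slice_proj) P \<theta>"
  have P: "P \<in> Ob PB"
    and \<theta>: "a \<in> A \<Longrightarrow> h \<in> Hom E a x \<Longrightarrow> \<theta> (a, h) \<in> Hom PB (fobj G a) P" for a h
    using c by (simp_all add: cocone_iff[OF x])
  define val where "val b = (\<lambda>(g, a, h). \<theta> (a, h) b g)" for b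
  have val_P: "val b t \<in> fobj P b" if "b \<in> B" "t \<in> triples b x" for b t
    using that Hom_PB_mem[OF \<theta>] by (auto simp: val_def triples_def fobj_G)
  have val_restr: "val b (restr b' b k t) = farr P b' b k (val b' t)"
    if "b \<in> B" "b' \<in> B" "k \<in> Hom D b b'" "t \<in> triples b' x" for b b' k t
  proof -
    obtain g a h where t: "t = (g, a, h)" by (metis prod_cases3)
    have "a \<in> A" "h \<in> Hom E a x" and g: "g \<in> Hom D b' (fobj F a)"
      using that by (auto simp: t triples_def)
    then have "\<theta> (a, h) b (farr (fobj G a) b' b k g) = farr P b' b k (\<theta> (a, h) b' g)"
      using \<theta>[of a h] that unfolding Hom_PB by (auto simp: fobj_G)
    then show ?thesis
      by (simp add: t val_def restr_def farr_fobj_G[OF g])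
  qed
  have ex: "\<exists>t. t \<in> triples b x \<and> composite b x t = f"
    if "b \<in> B" "f \<in> Hom D b (fobj F x)" for b f
    using conn[OF that(1) x that(2)] unfolding connected_Fact_iff by blast
  have val_eq: "val b s = val b t"
    if "b \<in> B" "s \<in> triples b x" "t \<in> triples b x" "composite b x s = composite b x t" for b s t
  proof -
    have "(s, t) \<in> conn b x (composite b x t)"
      using conn[OF that(1) x composite_in_Hom[OF that(1) x that(3)]] that(2-)
      unfolding connected_Fact_iff by blast
    then show ?thesis
      using cocone_conn[OF x c that(1)] by (cases s, cases t) (auto simp: val_def)
  qed
  \<comment> \<open>The value of \<open>u\<close> at \<open>f\<close> is read off from an arbitrary factorisation of \<open>f\<close>.\<close>
  define u where "u = (\<lambda>b\<in>B. \<lambda>f\<in>Hom D b (fobj F x).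
    val b (SOME t. t \<in> triples b x \<and> composite b x t = f))"
  have u: "u b (composite b x t) = val b t" if "b \<in> B" "t \<in> triples b x" for b t
  proof -
    let ?t = "SOME s. s \<in> triples b x \<and> composite b x s = composite b x t"
    have "?t \<in> triples b x \<and> composite b x ?t = composite b x t"
      by (rule someI[of _ t]) (simp add: that)
    then have "val b ?t = val b t"
      using val_eq that by blast
    then show ?thesis
      using that composite_in_Hom[OF _ x] by (simp add: u_def)
  qed
  have u_Hom: "u \<in> Hom PB (fobj G x) P"
    unfolding Hom_PB
  proof (intro conjI ballI)
    show "u \<in> (\<Pi>\<^sub>E b\<in>B. fobj (fobj G x) b \<rightarrow>\<^sub>E fobj P b)"
    proof (rule PiE_I)
      show "u b \<in> fobj (fobj G x) b \<rightarrow>\<^sub>E fobj P b" if b: "b \<in> B" for b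
      proof (rule PiE_I)
        show "u b f \<in> fobj P b" if "f \<in> fobj (fobj G x) b" for f
          using ex[OF b, of f] that u[OF b] val_P[OF b] by (auto simp: fobj_G)
      qed (simp add: u_def b fobj_G)
    qed (simp add: u_def)
  next
    fix b b' k f
    assume b: "b \<in> B" "b' \<in> B" and k: "k \<in> Hom D b b'" and f: "f \<in> fobj (fobj G x) b'"
    obtain t where t: "t \<in> triples b' x" "composite b' x t = f"
      using ex[OF b(2)] f unfolding fobj_G by blast
    have "farr (fobj G x) b' b k f = composite b x (restr b' b k t)"
      using f t composite_restr[OF b x k] by (simp add: fobj_G farr_fobj_G)
    then show "u b (farr (fobj G x) b' b k f) = farr P b' b k (u b' f)"
      using t(2) u[OF b(1) restr_in_triples[OF b k t(1)]] u[OF b(2) t(1)] val_restr[OF b k t(1)]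
      by simp
  qed (use P fun_obj[OF G_functor x] in auto)
  show "\<exists>!u. u \<in> Hom PB (fobj G x) P \<and>
      (\<forall>b\<in>B. \<forall>(g, a, h)\<in>triples b x. u b (composite b x (g, a, h)) = \<theta> (a, h) b g)"
  proof (intro ex1I[of _ u] conjI)
    show "\<forall>b\<in>B. \<forall>(g, a, h)\<in>triples b x. u b (composite b x (g, a, h)) = \<theta> (a, h) b g"
      using u by (auto simp: val_def)
  next
    fix w
    assume w: "w \<in> Hom PB (fobj G x) P \<and>
      (\<forall>b\<in>B. \<forall>(g, a, h)\<in>triples b x. w b (composite b x (g, a, h)) = \<theta> (a, h) b g)"
    show "w = u"
    proof (rule Hom_PB_eqI)
      fix b f assume b: "b \<in> B" and "f \<in> fobj (fobj G x) b"
      then obtain t where t: "t \<in> triples b x" "composite b x t = f"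
        using ex[OF b] unfolding fobj_G by blast
      have "w b (composite b x t) = val b t"
        using w b t(1) by (auto simp: val_def)
      then show "w b f = u b f"
        using u[OF b t(1)] t(2) by simp
    qed (use w u_Hom in auto)
  qed (rule u_Hom)
qed

section \<open>The presheaf of connected components\<close>

text \<open>Presheaves take values in subsets of \<open>'u\<close>, so triples have to be encoded as elements of \<open>'u\<close>.
  An injective encoding exists because \<open>A\<close> is small and \<open>'u\<close> is infinite.\<close>

definition encode :: "'u \<times> 'e \<times> 'u \<Rightarrow> 'u" where
  "encode = (SOME e. inj_on e (UNIV \<times> A \<times> UNIV))"

text \<open>The connected component of a triple in the factorisation category to which it belongs,
  represented by the code of a chosen member.\<close>

definition component :: "'f \<Rightarrow> 'e \<Rightarrow> 'u \<times> 'e \<times> 'u \<Rightarrow> 'u" where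
  "component b x t = encode (SOME t'. (t, t') \<in> conn b x (composite b x t))"

text \<open>The colimit of the nerves of the \<open>F a\<close> over all \<open>h : a \<rightarrow> x\<close>. Its value at \<open>b\<close> is the set of
  connected components of triples, and it acts by precomposition on representatives.\<close>

definition components :: "'e \<Rightarrow> ('f, 'u, 'u set, 'u \<Rightarrow> 'u) func" where
  "components x = \<lparr>fobj = (\<lambda>b. component b x ` triples b x),
     farr = (\<lambda>b' b k. \<lambda>s\<in>component b' x ` triples b' x.
       component b x (restr b' b k (SOME t. t \<in> triples b' x \<and> component b' x t = s)))\<rparr>"

lemma inj_on_encode:
  assumes "infinite (UNIV :: 'u set)"
  shows "inj_on encode (UNIV \<times> A \<times> UNIV)"
proof -
  have U: "(UNIV :: 'u set) \<times> (UNIV :: 'u set) \<lesssim> (UNIV :: 'u set)"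
    using card_of_Times_same_infinite[OF assms] unfolding card_of_ordIso[symmetric]
    by (auto simp: UNIV_Times_UNIV eqpoll_def intro!: eqpoll_imp_lepoll)
  have "A \<times> (UNIV :: 'u set) \<lesssim> (UNIV :: 'u set) \<times> (UNIV :: 'u set)"
    using EA by (intro times_lepoll_mono lepoll_refl) (simp add: category_with_arities_def)
  then have "(UNIV :: 'u set) \<times> A \<times> (UNIV :: 'u set) \<lesssim> (UNIV :: 'u set) \<times> (UNIV :: 'u set)"
    by (intro times_lepoll_mono lepoll_refl) (rule lepoll_trans[OF _ U])
  then have "(UNIV :: 'u set) \<times> A \<times> (UNIV :: 'u set) \<lesssim> (UNIV :: 'u set)"
    by (rule lepoll_trans[OF _ U])
  then show ?thesis
    unfolding lepoll_def encode_def by (metis (mono_tags, lifting) someI)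
qed

lemma component_eq_iff:
  assumes "infinite (UNIV :: 'u set)" and s: "s \<in> triples b x" and t: "t \<in> triples b x"
  shows "component b x s = component b x t \<longleftrightarrow>
    composite b x s = composite b x t \<and> (s, t) \<in> conn b x (composite b x t)" (is "?L \<longleftrightarrow> ?R")
proof
  have rep: "(r, SOME t'. (r, t') \<in> conn b x (composite b x r)) \<in> conn b x (composite b x r)" for r
    by (rule someI[of _ r]) (rule conn_refl)
  have rep_Ob: "(SOME t'. (r, t') \<in> conn b x (composite b x r)) \<in> Ob (Fact b x (composite b x r))"
    if "r \<in> triples b x" for r
    using that by (intro conn_Ob[OF rep]) (simp add: Ob_fact)
  {
    assume ?L
    moreover have "r \<in> UNIV \<times> A \<times> UNIV" if "r \<in> Ob (Fact b x f)" for r f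
      using that by (auto simp: Ob_fact triples_def)
    ultimately have eq: "(SOME t'. (s, t') \<in> conn b x (composite b x s)) =
        (SOME t'. (t, t') \<in> conn b x (composite b x t))"
      using inj_onD[OF inj_on_encode[OF assms(1)]] rep_Ob[OF s] rep_Ob[OF t]
      unfolding component_def by blast
    have f: "composite b x s = composite b x t"
      using rep_Ob[OF s] rep_Ob[OF t] unfolding eq by (simp add: Ob_fact)
    show ?R
      using rep[of s] conn_sym[OF rep[of t]] unfolding eq unfolding f by (blast intro: conn_trans)
  next
    assume ?R
    then have "(s, r) \<in> conn b x (composite b x s) \<longleftrightarrow> (t, r) \<in> conn b x (composite b x t)" for r
      using conn_sym[of s t] by (metis conn_trans)
    then show ?L
      by (simp add: component_def)
  }
qed

text \<open>Precomposition maps zigzags of factorisations of \<open>f\<close> to zigzags of factorisations of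
  \<open>f \<circ> k\<close>, so it acts on components.\<close>

lemma conn_restr:
  assumes b: "b \<in> B" "b' \<in> B" and x: "x \<in> Ob E" and k: "k \<in> Hom D b b'"
    and "(s, t) \<in> conn b' x f"
  shows "(restr b' b k s, restr b' b k t) \<in> conn b x (Cmp D b b' (fobj F x) f k)"
proof -
  have step: "(restr b' b k s, restr b' b k t) \<in> arrow_rel (Fact b x (Cmp D b b' (fobj F x) f k))"
    if st: "(s, t) \<in> arrow_rel (Fact b' x f)" for s t
  proof -
    obtain g a h g' a' h' where s: "s = (g, a, h)" and t: "t = (g', a', h')"
      by (metis prod_cases3)
    obtain m where m: "m \<in> Hom E a a'" "Cmp D b' (fobj F a) (fobj F a') (farr F a a' m) g = g'"
      "Cmp E a a' x h' m = h"
      using st unfolding s t by (rule arrow_rel_factD)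
    have "s \<in> triples b' x" "t \<in> triples b' x" "composite b' x s = f" "composite b' x t = f"
      using st by (auto simp: arrow_rel_def Ob_fact)
    then have Ob: "restr b' b k s \<in> Ob (Fact b x (Cmp D b b' (fobj F x) f k))"
        "restr b' b k t \<in> Ob (Fact b x (Cmp D b b' (fobj F x) f k))"
      using restr_in_triples[OF b k] composite_restr[OF b x k] by (auto simp: Ob_fact)
    have a: "a \<in> A" "a' \<in> A" "g \<in> Hom D b' (fobj F a)"
      using \<open>s \<in> triples b' x\<close> \<open>t \<in> triples b' x\<close> by (auto simp: s t triples_def)
    have "Cmp D b (fobj F a) (fobj F a') (farr F a a' m) (Cmp D b b' (fobj F a) g k) =
        Cmp D b b' (fobj F a') g' k"
      using cat_assoc[OF D B_Ob[OF b(1)] B_Ob[OF b(2)] F_Ob[OF A_Ob[OF a(1)]]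
          F_Ob[OF A_Ob[OF a(2)]] k a(3) fun_arr[OF F A_Ob[OF a(1)] A_Ob[OF a(2)] m(1)]] m(2)
      by simp
    then have "m \<in> Hom (Fact b x (Cmp D b b' (fobj F x) f k)) (restr b' b k s) (restr b' b k t)"
      using m by (simp add: s t restr_def fact_cat_def)
    with Ob show ?thesis
      by (auto simp: arrow_rel_def)
  qed
  show ?thesis
    using assms(5) unfolding conn_def
    by (induction rule: rtrancl_induct) (auto dest: step intro: rtrancl_into_rtrancl)
qed

lemma fobj_components: "fobj (components x) b = component b x ` triples b x"
  by (simp add: components_def)

lemma farr_components:
  assumes inf: "infinite (UNIV :: 'u set)" and b: "b \<in> B" "b' \<in> B" and x: "x \<in> Ob E"
    and k: "k \<in> Hom D b b'" and t: "t \<in> triples b' x"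
  shows "farr (components x) b' b k (component b' x t) = component b x (restr b' b k t)"
proof -
  define r where "r = (SOME r. r \<in> triples b' x \<and> component b' x r = component b' x t)"
  have r: "r \<in> triples b' x \<and> component b' x r = component b' x t"
    unfolding r_def by (rule someI[where x = t]) (simp add: t)
  then have eq: "composite b' x r = composite b' x t" "(r, t) \<in> conn b' x (composite b' x t)"
    using component_eq_iff[OF inf _ t] by blast+
  have "component b x (restr b' b k r) = component b x (restr b' b k t)"
    using r t eq conn_restr[OF b x k eq(2)]
    by (simp add: component_eq_iff[OF inf] restr_in_triples[OF b k] composite_restr[OF b x k])
  then show ?thesis
    using t by (simp add: components_def r_def)
qed

lemma components_Ob:
  assumes inf: "infinite (UNIV :: 'u set)" and x: "x \<in> Ob E"
  shows "components x \<in> Ob PB"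
proof -
  have B: "is_category (full_subcat D B)"
    using DB by (intro is_category_full_subcat[OF D]) (simp add: category_with_arities_def)
  have arr: "farr (components x) b' b k \<in> fobj (components x) b' \<rightarrow>\<^sub>E fobj (components x) b"
    if "b \<in> B" "b' \<in> B" "k \<in> Hom D b b'" for b b' k
  proof (rule PiE_I)
    show "farr (components x) b' b k s \<in> fobj (components x) b" if "s \<in> fobj (components x) b'" for s
      using that farr_components[OF inf \<open>b \<in> B\<close> \<open>b' \<in> B\<close> x \<open>k \<in> Hom D b b'\<close>]
        restr_in_triples[OF \<open>b \<in> B\<close> \<open>b' \<in> B\<close> \<open>k \<in> Hom D b b'\<close>]
      by (auto simp: fobj_components)
  qed (simp add: components_def)
  have idn: "farr (components x) b b (Idn D b) = (\<lambda>s\<in>fobj (components x) b. s)" if b: "b \<in> B" for b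
  proof (rule PiE_ext[OF arr[OF b b cat_idn[OF D B_Ob[OF b]]]])
    fix s assume "s \<in> fobj (components x) b"
    then obtain t where t: "t \<in> triples b x" and s: "s = component b x t"
      by (auto simp: fobj_components)
    have "restr b b (Idn D b) t = t"
      using t b by (auto simp: restr_def triples_def cat_idn_right[OF D] B_Ob F_Ob A_Ob)
    then show "farr (components x) b b (Idn D b) s = (\<lambda>s\<in>fobj (components x) b. s) s"
      using farr_components[OF inf b b x cat_idn[OF D B_Ob[OF b]] t] t
      by (simp add: s fobj_components)
  qed auto
  have cmp: "farr (components x) b'' b (Cmp D b b' b'' l k) =
      compose (fobj (components x) b'') (farr (components x) b' b k) (farr (components x) b'' b' l)"
    if b: "b \<in> B" "b' \<in> B" "b'' \<in> B" and k: "k \<in> Hom D b b'" and l: "l \<in> Hom D b' b''"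
    for b b' b'' k l
  proof -
    have lk: "Cmp D b b' b'' l k \<in> Hom D b b''"
      by (intro cat_cmp[OF D] B_Ob b k l)
    show ?thesis
    proof (rule PiE_ext[OF arr[OF b(1,3) lk]])
      show "compose (fobj (components x) b'') (farr (components x) b' b k)
          (farr (components x) b'' b' l) \<in> fobj (components x) b'' \<rightarrow>\<^sub>E fobj (components x) b"
        using arr[OF b(1,2) k] arr[OF b(2,3) l] by (auto simp: compose_def PiE_iff)
    next
      fix s assume "s \<in> fobj (components x) b''"
      then obtain t where t: "t \<in> triples b'' x" and s: "s = component b'' x t"
        by (auto simp: fobj_components)
      have "restr b'' b (Cmp D b b' b'' l k) t = restr b' b k (restr b'' b' l t)"
        using t b k l by (auto simp: restr_def triples_def cat_assoc[OF D] B_Ob F_Ob A_Ob)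
      then show "farr (components x) b'' b (Cmp D b b' b'' l k) s =
          compose (fobj (components x) b'') (farr (components x) b' b k)
            (farr (components x) b'' b' l) s"
        using farr_components[OF inf b(1,3) x lk t] farr_components[OF inf b(2,3) x l t]
          farr_components[OF inf b(1,2) x k restr_in_triples[OF b(2,3) l t]] t
        by (simp add: s compose_def fobj_components)
    qed
  qed
  have "is_functor (op_cat (full_subcat D B)) set_cat (components x)"
    using is_category_op_cat[OF B] is_category_set_cat arr idn cmp
    by (simp add: is_functor_def op_cat_def full_subcat_def set_cat_def)
  then show ?thesis
    by (simp add: presheaf_cat_def functor_cat_def)
qed

text \<open>This is the colimit cocone, but only the cocone property is needed.\<close>

lemma components_cocone:
  assumes inf: "infinite (UNIV :: 'u set)" and x: "x \<in> Ob E"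
  shows "is_cocone (J x) PB (comp_func G slice_proj) (components x)
    (\<lambda>(a, h)\<in>Ob (J x). \<lambda>b\<in>B. \<lambda>g\<in>Hom D b (fobj F a). component b x (g, a, h))"
  unfolding cocone_iff[OF x]
proof (intro conjI ballI)
  fix a h assume a: "a \<in> A" "h \<in> Hom E a x"
  show "(\<lambda>(a, h)\<in>Ob (J x). \<lambda>b\<in>B. \<lambda>g\<in>Hom D b (fobj F a). component b x (g, a, h)) (a, h)
      \<in> Hom PB (fobj G a) (components x)"
    using a components_Ob[OF inf x] fun_obj[OF G_functor A_Ob[OF a(1)]]
    by (auto simp: Hom_PB Ob_J fobj_G farr_fobj_G fobj_components triples_def restr_def
        farr_components[OF inf _ _ x] cat_cmp[OF D] B_Ob F_Ob A_Ob)
next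
  fix a a' h' k b g
  assume a: "a \<in> A" "a' \<in> A" "h' \<in> Hom E a' x" and k: "k \<in> Hom E a a'"
    and b: "b \<in> B" and g: "g \<in> Hom D b (fobj F a)"
  let ?g = "Cmp D b (fobj F a) (fobj F a') (farr F a a' k) g" and ?h = "Cmp E a a' x h' k"
  have h: "?h \<in> Hom E a x"
    using a k x by (auto intro: cat_cmp[OF E] A_Ob)
  have g': "?g \<in> Hom D b (fobj F a')"
    using a k b g by (auto intro: cat_cmp[OF D] A_Ob F_Ob B_Ob fun_arr[OF F])
  have s: "(g, a, ?h) \<in> triples b x" and t: "(?g, a', h') \<in> triples b x"
    using a h g g' by (auto simp: triples_def)
  have eq: "composite b x (?g, a', h') = composite b x (g, a, ?h)"
    using a k b g x by (intro composite_transport) auto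
  have "k \<in> Hom (Fact b x f) (g, a, ?h) (?g, a', h')" for f
    using k by (simp add: fact_cat_def)
  then have "((g, a, ?h), (?g, a', h')) \<in> arrow_rel (Fact b x (composite b x (?g, a', h')))"
    using s t eq by (auto simp: arrow_rel_def Ob_fact)
  then have "component b x (g, a, ?h) = component b x (?g, a', h')"
    using eq by (auto simp: component_eq_iff[OF inf s t] conn_def)
  then show "(\<lambda>(a, h)\<in>Ob (J x). \<lambda>b\<in>B. \<lambda>g\<in>Hom D b (fobj F a). component b x (g, a, h)) (a', h') b ?g =
      (\<lambda>(a, h)\<in>Ob (J x). \<lambda>b\<in>B. \<lambda>g\<in>Hom D b (fobj F a). component b x (g, a, h)) (a, ?h) b g"
    using a b g g' h by (simp add: Ob_J)
qed (use components_Ob[OF inf x] in auto)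

text \<open>Sending the component of \<open>(g, a, h)\<close> to \<open>F h \<circ> g\<close> is a transformation to the nerve of \<open>F x\<close>.\<close>

lemma components_to_nerve:
  assumes inf: "infinite (UNIV :: 'u set)" and x: "x \<in> Ob E"
  obtains v where "v \<in> Hom PB (components x) (fobj G x)"
    and "\<And>b t. b \<in> B \<Longrightarrow> t \<in> triples b x \<Longrightarrow> v b (component b x t) = composite b x t"
proof
  define v where "v = (\<lambda>b\<in>B. \<lambda>s\<in>component b x ` triples b x.
    composite b x (SOME t. t \<in> triples b x \<and> component b x t = s))"
  show v: "v b (component b x t) = composite b x t" if "b \<in> B" "t \<in> triples b x" for b t
  proof -
    let ?r = "SOME r. r \<in> triples b x \<and> component b x r = component b x t"
    have "?r \<in> triples b x \<and> component b x ?r = component b x t"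
      by (rule someI[where x = t]) (simp add: that)
    then have "composite b x ?r = composite b x t"
      using component_eq_iff[OF inf _ that(2)] by blast
    then show ?thesis
      using that by (simp add: v_def)
  qed
  show "v \<in> Hom PB (components x) (fobj G x)"
    unfolding Hom_PB
  proof (intro conjI ballI)
    show "v \<in> (\<Pi>\<^sub>E b\<in>B. fobj (components x) b \<rightarrow>\<^sub>E fobj (fobj G x) b)"
    proof (rule PiE_I)
      show "v b \<in> fobj (components x) b \<rightarrow>\<^sub>E fobj (fobj G x) b" if b: "b \<in> B" for b
      proof (rule PiE_I)
        show "v b s \<in> fobj (fobj G x) b" if "s \<in> fobj (components x) b" for s
          using that v[OF b] composite_in_Hom[OF b x] by (auto simp: fobj_components fobj_G)
      qed (simp add: v_def b fobj_components)
    qed (simp add: v_def)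
  next
    fix b b' k s
    assume b: "b \<in> B" "b' \<in> B" and k: "k \<in> Hom D b b'" and "s \<in> fobj (components x) b'"
    then obtain t where t: "t \<in> triples b' x" and s: "s = component b' x t"
      by (auto simp: fobj_components)
    show "v b (farr (components x) b' b k s) = farr (fobj G x) b' b k (v b' s)"
      using t composite_in_Hom[OF b(2) x t]
      by (simp add: s farr_components[OF inf b x k] v b restr_in_triples[OF b k]
          composite_restr[OF b x k] farr_fobj_G)
  qed (use components_Ob[OF inf x] fun_obj[OF G_functor x] in auto)
qed

section \<open>Colimits give connected factorisation categories\<close>

text \<open>The universal property yields \<open>u\<close> with \<open>u b (F h \<circ> g)\<close> the component of \<open>(g, a, h)\<close>. It has the
  left inverse \<open>v\<close> constructed above, so every \<open>f = v b (u b f)\<close> is a composite; and two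
  factorisations of \<open>f\<close> both have component \<open>u b f\<close>.\<close>

lemma connected_if_respects_arities:
  assumes inf: "infinite (UNIV :: 'u set)" and resp: "respects_arities E A D B F"
    and b: "b \<in> B" and x: "x \<in> Ob E" and f: "f \<in> Hom D b (fobj F x)"
  shows "connected_cat (Fact b x f)"
proof -
  note univ = resp[unfolded respects_arities_iff, rule_format, OF x]
  from univ[OF components_cocone[OF inf x]]
  obtain u where u_Hom: "u \<in> Hom PB (fobj G x) (components x)" and
    "\<forall>b\<in>B. \<forall>(g, a, h)\<in>triples b x. u b (composite b x (g, a, h)) =
      (\<lambda>(a, h)\<in>Ob (J x). \<lambda>b\<in>B. \<lambda>g\<in>Hom D b (fobj F a). component b x (g, a, h)) (a, h) b g"
    by blast
  then have u: "u b (composite b x t) = component b x t" if "b \<in> B" "t \<in> triples b x" for b t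
    using that by (force simp: triples_def Ob_J)
  obtain v where v_Hom: "v \<in> Hom PB (components x) (fobj G x)"
    and v: "\<And>b t. b \<in> B \<Longrightarrow> t \<in> triples b x \<Longrightarrow> v b (component b x t) = composite b x t"
    using components_to_nerve[OF inf x] by blast
  have Gx: "fobj G x \<in> Ob PB"
    by (rule fun_obj[OF G_functor x])
  define w where "w = Cmp PB (fobj G x) (components x) (fobj G x) v u"
  have w_Hom: "w \<in> Hom PB (fobj G x) (fobj G x)"
    unfolding w_def by (rule cat_cmp[OF PB Gx components_Ob[OF inf x] Gx u_Hom v_Hom])
  \<comment> \<open>Both \<open>v \<circ> u\<close> and the identity are compatible with the canonical cocone, hence equal.\<close>
  have canonical: "map_cocone (J x) G slice_proj x (canonical_cocone E A x) (a, h) b g =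
      composite b x (g, a, h)" if "b \<in> B" "(g, a, h) \<in> triples b x" for b g a h
    using that by (auto simp: triples_def canonical_cocone_apply farr_G_composite)
  have compat: "\<forall>b\<in>B. \<forall>(g, a, h)\<in>triples b x. y b (composite b x (g, a, h)) =
      map_cocone (J x) G slice_proj x (canonical_cocone E A x) (a, h) b g"
    if "\<And>b t. b \<in> B \<Longrightarrow> t \<in> triples b x \<Longrightarrow> y b (composite b x t) = composite b x t" for y
    by (auto simp: canonical that)
  have w: "w b (composite b x t) = composite b x t" if "b \<in> B" "t \<in> triples b x" for b t
    using that composite_in_Hom[OF that(1) x that(2)] by (simp add: w_def Cmp_PB fobj_G u v)
  have idn: "Idn PB (fobj G x) b (composite b x t) = composite b x t"
    if "b \<in> B" "t \<in> triples b x" for b t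
    using that composite_in_Hom[OF that(1) x that(2)] by (simp add: Idn_PB fobj_G)
  have "w = Idn PB (fobj G x)"
    using univ[OF canonical_is_cocone[OF x]] w_Hom compat[OF w] cat_idn[OF PB Gx] compat[OF idn]
    by blast
  then have "v b (u b f) = f"
    using Cmp_PB[of b f "fobj G x" "components x" "fobj G x" v u] Idn_PB[of b f "fobj G x"] b f
    by (simp add: w_def fobj_G)
  moreover have "u b f \<in> component b x ` triples b x"
    using Hom_PB_mem[OF u_Hom b] f by (simp add: fobj_G fobj_components)
  ultimately have "Ob (Fact b x f) \<noteq> {}"
    using v[OF b] unfolding Ob_fact by force
  moreover have "(s, t) \<in> conn b x f" if "s \<in> Ob (Fact b x f)" "t \<in> Ob (Fact b x f)" for s t
  proof -
    have st: "s \<in> triples b x" "t \<in> triples b x" "composite b x s = f" "composite b x t = f"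
      using that by (auto simp: Ob_fact)
    then have "component b x s = component b x t"
      using u[OF b st(1)] u[OF b st(2)] by simp
    then show ?thesis
      using component_eq_iff[OF inf st(1,2)] st(4) by simp
  qed
  ultimately show ?thesis
    by (auto simp: connected_Fact_iff Ob_fact)
qed

end

section \<open>Functors that respect arities\<close>

theorem proposition2p5:
  fixes \<E> :: "('e, 'u) cat" and \<A> :: "'e set"
    and \<F> :: "('f, 'u) cat" and \<B> :: "'f set"
    and F :: "('e, 'u, 'f, 'u) func"
  assumes "infinite (UNIV :: 'u set)"
    and "category_with_arities \<E> \<A>"
    and "category_with_arities \<F> \<B>"
    and "is_functor \<E> \<F> F"
  shows "respects_arities \<E> \<A> \<F> \<B> F \<longleftrightarrow>
    (\<forall>b\<in>\<B>. \<forall>x\<in>Ob \<E>. \<forall>f\<in>Hom \<F> b (fobj F x). connected_cat (fact_cat \<E> \<A> \<F> F b x f))"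
proof -
  interpret arity_functor \<E> \<A> \<F> \<B> F
    using assms(2-4) by unfold_locales
  show ?thesis
    using respects_arities_if_connected connected_if_respects_arities[OF assms(1)] by blast
qed

end
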